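(* $\mathrm{WL}_1\not\preceq\omega^{(3)}$: there exist graphs $G$ and $H$ with $\omega^{(3)}(G)=\omega^{(3)}(H)$ but $\mathrm{WL}_1(G)\ne\mathrm{WL}_1(H)$.
   Context: Graphs are finite, simple and undirected; an $N$-vertex graph has $V(G)=\{1,\dots,N\}$. Let $w_k(x,y)$ be the number of walks of length $k$ from $x$ to $y$, $w_*(x,y)=(w_0(x,y),\dots,w_{N-1}(x,y))$. Define $\omega_0(x)=w_*(x,x)$, $\omega_{r+1}(x)=\big(\omega_r(x),\{\!\{(w_*(x,y),\omega_r(y))\}\!\}_{y\in V(G)}\big)$, where $\{\!\{\cdot\}\!\}$ denotes a multiset, and $\omega^{(r)}(G)=\{\!\{\omega_r(x)\}\!\}_{x\in V(G)}$. Color refinement: $C^0(x)$ uniform, $C^{r+1}(x)=\big(C^r(x),\{\!\{C^r(y)\}\!\}_{y\in N(x)}\big)$; $\mathrm{WL}_1(G)=\{\!\{C^N(x)\}\!\}_{x\in V(G)}$. *)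

theory Defs
  imports Main "HOL-Library.Multiset"
begin

definition is_graph :: "nat \<Rightarrow> (nat \<Rightarrow> nat \<Rightarrow> bool) \<Rightarrow> bool" where
  "is_graph N E \<longleftrightarrow> (\<forall>x y. E x y \<longrightarrow> x \<in> {1..N} \<and> y \<in> {1..N} \<and> x \<noteq> y \<and> E y x)"

fun walks :: "nat \<Rightarrow> (nat \<Rightarrow> nat \<Rightarrow> bool) \<Rightarrow> nat \<Rightarrow> nat \<Rightarrow> nat \<Rightarrow> nat" where
  "walks N E 0 x y = (if x = y then 1 else 0)"
| "walks N E (Suc k) x y = (\<Sum>z\<in>{z\<in>{1..N}. E x z}. walks N E k z y)"

definition walk_vec :: "nat \<Rightarrow> (nat \<Rightarrow> nat \<Rightarrow> bool) \<Rightarrow> nat \<Rightarrow> nat \<Rightarrow> nat list" where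
  "walk_vec N E x y = map (\<lambda>k. walks N E k x y) [0..<N]"

datatype omega_val = OLeaf "nat list" | ONode omega_val "(nat list \<times> omega_val) multiset"

fun omega :: "nat \<Rightarrow> (nat \<Rightarrow> nat \<Rightarrow> bool) \<Rightarrow> nat \<Rightarrow> nat \<Rightarrow> omega_val" where
  "omega N E 0 x = OLeaf (walk_vec N E x x)"
| "omega N E (Suc r) x =
     ONode (omega N E r x) (image_mset (\<lambda>y. (walk_vec N E x y, omega N E r y)) (mset_set {1..N}))"

definition omega_inv :: "nat \<Rightarrow> nat \<Rightarrow> (nat \<Rightarrow> nat \<Rightarrow> bool) \<Rightarrow> omega_val multiset" where
  "omega_inv r N E = image_mset (omega N E r) (mset_set {1..N})"

datatype color = CInit | CRefine color "color multiset"

fun cr :: "nat \<Rightarrow> (nat \<Rightarrow> nat \<Rightarrow> bool) \<Rightarrow> nat \<Rightarrow> nat \<Rightarrow> color" where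
  "cr N E 0 x = CInit"
| "cr N E (Suc r) x = CRefine (cr N E r x) (image_mset (cr N E r) (mset_set {y\<in>{1..N}. E x y}))"

definition WL1 :: "nat \<Rightarrow> (nat \<Rightarrow> nat \<Rightarrow> bool) \<Rightarrow> color multiset" where
  "WL1 N E = image_mset (cr N E N) (mset_set {1..N})"

end

theory Submission
  imports Defs
begin

text \<open>
  Let \<open>R\<^sub>0\<close> be the hexagon plus an isolated vertex and \<open>R\<^sub>1\<close> the spider with three legs of length
  two.  In both graphs the degree vector is an eigenvector for the eigenvalue 2, and both have
  7 vertices and 6 edges; hence walks passing through a copy of \<open>R\<^sub>0\<close> all of whose vertices have
  the same outside neighbours are counted in the same way after replacing it by \<open>R\<^sub>1\<close>.
  Starting from such a pair \<open>A\<^sub>0, A\<^sub>1\<close>, pass to the pair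
  \<open>A\<^sub>0 * A\<^sub>0 + A\<^sub>1 * A\<^sub>1\<close> and \<open>A\<^sub>0 * A\<^sub>1 + A\<^sub>0 * A\<^sub>1\<close>, where \<open>+\<close> is disjoint union and \<open>*\<close> is join.
  Both contain two copies of each of \<open>A\<^sub>0\<close> and \<open>A\<^sub>1\<close>, and walk counts do not reveal which of the two
  sits where, so every such step costs \<open>\<omega>\<close> one more round; color refinement
  still separates the two graphs, because the types of joined blocks agree in one and differ in
  the other.

  Unfolding the recursion, a vertex is a word of pairs of bits, outermost level first, together
  with a vertex of a leaf graph.  At each level the first bit names the summand of the disjoint
  union and the second one the factor of the join.
\<close>

section \<open>Words and their separation\<close>

type_synonym word = "(bool \<times> bool) list"

definition words :: "nat \<Rightarrow> word set" where
  "words n = {u. length u = n}"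

text \<open>\<open>sep u w\<close> encodes the first place where \<open>u\<close> and \<open>w\<close> differ, counted from the end. It is odd iff
  they lie in different factors of a join, positive and even iff they lie in different summands.\<close>

fun sep :: "word \<Rightarrow> word \<Rightarrow> nat" where
  "sep (a # u) (b # w) =
     (if a = b then sep u w
      else if fst a = fst b then Suc (2 * length u) else Suc (Suc (2 * length u)))"
| "sep _ _ = 0"

lemma finite_words [simp]: "finite (words n)"
  using finite_lists_length_eq[of "UNIV :: (bool \<times> bool) set" n] by (simp add: words_def)

lemma words_0 [simp]: "words 0 = {[]}"
  by (auto simp: words_def)

lemma words_iff: "u \<in> words n \<longleftrightarrow> length u = n"
  by (simp add: words_def)

lemma words_Suc: "words (Suc n) = (\<lambda>(a, u). a # u) ` (UNIV \<times> words n)"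
  by (force simp: words_def length_Suc_conv)

lemma sum_words_Suc:
  fixes f :: "word \<Rightarrow> 'a::comm_monoid_add"
  shows "(\<Sum>u\<in>words (Suc n). f u) = (\<Sum>a\<in>UNIV. \<Sum>u\<in>words n. f (a # u))"
proof -
  have inj: "inj_on (\<lambda>(a, u). a # u) (UNIV \<times> words n)"
    by (auto simp: inj_on_def)
  show ?thesis
    unfolding words_Suc sum.reindex[OF inj] sum.cartesian_product
    by (rule sum.cong) auto
qed

lemma sum_bool_pair:
  fixes f :: "bool \<times> bool \<Rightarrow> 'a::comm_monoid_add"
  shows "(\<Sum>e\<in>UNIV. f e) = f (False, False) + f (False, True) + f (True, False) + f (True, True)"
proof -
  have "(UNIV :: (bool \<times> bool) set) = {(False, False), (False, True), (True, False), (True, True)}"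
    by auto
  from arg_cong[OF this, of "sum f"] show ?thesis by (simp add: add.assoc)
qed

lemma card_words: "card (words n) = 4 ^ n"
proof (induction n)
  case (Suc n)
  have "(\<Sum>u\<in>words (Suc n). 1::nat) = (\<Sum>a\<in>(UNIV :: (bool \<times> bool) set). \<Sum>u\<in>words n. 1)"
    by (rule sum_words_Suc)
  with Suc show ?case by (simp only: sum_bool_pair) simp
qed simp

lemma sum_words_append:
  fixes f :: "word \<Rightarrow> 'a::comm_monoid_add"
  shows "(\<Sum>u\<in>words (n + k). f u) = (\<Sum>h\<in>words n. \<Sum>l\<in>words k. f (h @ l))"
  by (induction n arbitrary: f) (simp_all add: sum_words_Suc)

lemma sum_words_split:
  fixes f :: "word \<Rightarrow> 'a::comm_monoid_add"
  assumes "m = n + Suc k"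
  shows "(\<Sum>u\<in>words m. f u) = (\<Sum>h\<in>words n. \<Sum>e\<in>UNIV. \<Sum>l\<in>words k. f (h @ e # l))"
  by (simp only: assms sum_words_append sum_words_Suc)

lemma sep_self [simp]: "sep u u = 0"
  by (induction u) auto

lemma sep_eq_0_iff: "length u = length w \<Longrightarrow> sep u w = 0 \<longleftrightarrow> u = w"
  by (induction u w rule: list_induct2) auto

lemma sep_commute: "length u = length w \<Longrightarrow> sep u w = sep w u"
  by (induction u w rule: list_induct2) auto

lemma sep_le: "length u = length w \<Longrightarrow> sep u w \<le> 2 * length u"
  by (induction u w rule: list_induct2) auto

text \<open>A difference in the prefixes gains two per letter of the tail, so its parity survives; a
  common prefix leaves the value on the tails unchanged.\<close>

lemma sep_append:
  assumes "length h = length h'" and "length l = length l'"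
  shows "sep (h @ l) (h' @ l') = (if h = h' then sep l l' else sep h h' + 2 * length l)"
  using assms by (induction h h' rule: list_induct2) auto

text \<open>The relations \<open>sep z u = i\<close> form an association scheme; these are its
  intersection numbers in weighted form. Induction splits off the first letter of
  \<open>w\<close>.\<close>

lemma sum_sep_cong:
  fixes g :: "nat \<Rightarrow> nat \<Rightarrow> nat"
  assumes "length z = n" "length u = n" "length z' = n" "length u' = n"
    and "sep z u = sep z' u'"
  shows "(\<Sum>w\<in>words n. g (sep w z) (sep w u)) = (\<Sum>w\<in>words n. g (sep w z') (sep w u'))"
  using assms
proof (induction n arbitrary: g z u z' u')
  case (Suc n)
  from Suc.prems obtain a y b v a' y' b' v' where
    eqs: "z = a # y" "u = b # v" "z' = a' # y'" "u' = b' # v'"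
    and len: "length y = n" "length v = n" "length y' = n" "length v' = n"
    by (auto simp: length_Suc_conv)
  have bound: "sep y v \<le> 2 * n" "sep y' v' \<le> 2 * n"
    using sep_le[of y v] sep_le[of y' v'] len by simp_all
  let ?c = "Suc (2 * n)" and ?d = "Suc (Suc (2 * n))"
  have split: "(\<Sum>w\<in>words (Suc n). g (sep w (a # y)) (sep w (b # v))) =
      (if a = b then (\<Sum>w\<in>words n. g (sep w y) (sep w v)) + 4 ^ n * (g ?c ?c + 2 * g ?d ?d)
       else if fst a = fst b then
         (\<Sum>w\<in>words n. g (sep w y) ?c) + (\<Sum>w\<in>words n. g ?c (sep w v)) + 4 ^ n * (2 * g ?d ?d)
       else (\<Sum>w\<in>words n. g (sep w y) ?d) + (\<Sum>w\<in>words n. g ?d (sep w v)) +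
         4 ^ n * (g ?c ?d + g ?d ?c))"
    for a b y v
  proof -
    have "(\<Sum>w\<in>words (Suc n). g (sep w (a # y)) (sep w (b # v))) =
        (\<Sum>c\<in>UNIV. \<Sum>w\<in>words n.
          g (if c = a then sep w y else if fst c = fst a then ?c else ?d)
            (if c = b then sep w v else if fst c = fst b then ?c else ?d))"
      unfolding sum_words_Suc by (intro sum.cong refl) (simp add: words_def)
    moreover obtain a1 a2 b1 b2 where "a = (a1, a2)" "b = (b1, b2)"
      by (meson surj_pair)
    ultimately show ?thesis
      by (cases a1; cases a2; cases b1; cases b2)
        (simp_all add: sum_bool_pair card_words distrib_left)
  qed
  have single: "(\<Sum>w\<in>words n. G (sep w x)) = (\<Sum>w\<in>words n. G (sep w x'))"
    if "length x = n" "length x' = n" for G :: "nat \<Rightarrow> nat" and x x'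
    using Suc.IH[of x x x' x' "\<lambda>i _. G i"] that by simp
  \<comment> \<open>On tails \<open>sep\<close> is at most \<open>2 * n\<close>, below
    \<open>?c\<close> and \<open>?d\<close>, so the common value reveals the case on both
    sides.\<close>
  have both: "a = b \<and> a' = b' \<and> sep y v = sep y' v' \<or>
      a \<noteq> b \<and> a' \<noteq> b' \<and> (fst a = fst b) = (fst a' = fst b')"
    using Suc.prems(5) bound unfolding eqs sep.simps len by (simp split: if_splits)
  from both show ?case
  proof
    assume "a = b \<and> a' = b' \<and> sep y v = sep y' v'"
    then show ?thesis
      unfolding eqs split using Suc.IH[of y v y' v' g] len by simp
  next
    assume neq: "a \<noteq> b \<and> a' \<noteq> b' \<and> (fst a = fst b) = (fst a' = fst b')"
    show ?thesis
      unfolding eqs split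
        single[OF len(1,3), of "\<lambda>i. g i ?c"] single[OF len(2,4), of "g ?c"]
        single[OF len(1,3), of "\<lambda>i. g i ?d"] single[OF len(2,4), of "g ?d"]
      using neq by simp
  qed
qed simp

lemma sum_odd_sep:
  fixes t :: "nat \<Rightarrow> nat"
  obtains H where "\<And>z u. length z = n \<Longrightarrow> length u = n \<Longrightarrow>
    (\<Sum>w\<in>{w \<in> words n. odd (sep z w)}. t (sep w u)) = H (sep z u)"
proof -
  define S where "S z u = (\<Sum>w\<in>{w \<in> words n. odd (sep z w)}. t (sep w u))" for z u
  have S: "S z u = (\<Sum>w\<in>words n. if odd (sep w z) then t (sep w u) else 0)"
    if "length z = n" for z u
  proof -
    have "{w \<in> words n. odd (sep z w)} = {w \<in> words n. odd (sep w z)}"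
      using that by (auto simp: words_def sep_commute)
    then show ?thesis
      unfolding S_def by (simp add: sum.inter_filter)
  qed
  \<comment> \<open>Any witness pair may define \<open>H i\<close>, as the sum depends only on its
    \<open>sep\<close>; at values that are not attained \<open>H\<close> is arbitrary.\<close>
  define H where "H i = (SOME x. \<exists>z u. length z = n \<and> length u = n \<and> sep z u = i \<and> x = S z u)" for i
  have "S z u = H (sep z u)" if "length z = n" "length u = n" for z u
  proof -
    have "\<exists>z' u'. length z' = n \<and> length u' = n \<and> sep z' u' = sep z u \<and> H (sep z u) = S z' u'"
      unfolding H_def by (rule someI_ex) (use that in blast)
    then obtain z' u' where "length z' = n" "length u' = n" "sep z' u' = sep z u"
      "H (sep z u) = S z' u'" by blast
    then show ?thesis
      using sum_sep_cong[of z n u z' u' "\<lambda>i j. if odd i then t j else 0"] that by (simp add: S)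
  qed
  then show thesis
    by (intro that) (simp add: S_def)
qed

lemma card_odd_sep:
  obtains K where "\<And>u. length u = n \<Longrightarrow> card {w \<in> words n. odd (sep u w)} = K"
proof (rule sum_odd_sep[of n "\<lambda>_. 1"])
  fix H :: "nat \<Rightarrow> nat"
  assume H: "\<And>z u. length z = n \<Longrightarrow> length u = n \<Longrightarrow>
    (\<Sum>w\<in>{w \<in> words n. odd (sep z w)}. 1) = H (sep z u)"
  have "card {w \<in> words n. odd (sep u w)} = H 0" if "length u = n" for u
    using H[OF that that] by simp
  then show thesis by (rule that)
qed

section \<open>Translations of words\<close>

definition xor_word :: "word \<Rightarrow> word \<Rightarrow> word" where
  "xor_word t u = map2 (\<lambda>a b. (fst a \<noteq> fst b, snd a \<noteq> snd b)) t u"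

lemma xor_word_simps [simp]:
  "xor_word [] u = []"
  "xor_word (a # t) (b # u) = (fst a \<noteq> fst b, snd a \<noteq> snd b) # xor_word t u"
  by (simp_all add: xor_word_def)

lemma length_xor_word [simp]: "length (xor_word t u) = min (length t) (length u)"
  by (simp add: xor_word_def)

text \<open>\<open>sep\<close> sees only equality of letters and of first bits, and both survive
  adding a fixed mask.\<close>

lemma sep_xor_word:
  "length t = length u \<Longrightarrow> length u = length w \<Longrightarrow> sep (xor_word t u) (xor_word t w) = sep u w"
  by (induction t u w rule: list_induct3) (auto simp: prod_eq_iff)

lemma xor_word_cancel: "length t = length u \<Longrightarrow> xor_word t (xor_word t u) = u"
  by (induction t u rule: list_induct2) (auto simp: prod_eq_iff)

lemma xor_word_cancel_right: "length t = length u \<Longrightarrow> xor_word (xor_word u t) u = t"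
  by (induction t u rule: list_induct2) (auto simp: prod_eq_iff)

text \<open>\<open>select s u\<close> is the type of the block at \<open>u\<close> inside a graph of type \<open>s\<close>: blocks inherit the
  name of their summand (type \<open>False\<close>) or of their factor (type \<open>True\<close>).\<close>

fun select :: "bool \<Rightarrow> word \<Rightarrow> bool" where
  "select s [] = s"
| "select s (e # u) = select (if s then snd e else fst e) u"

lemma select_append [simp]: "select s (h @ l) = select (select s h) l"
  by (induction h arbitrary: s) auto


section \<open>The two leaf graphs\<close>

text \<open>\<open>False\<close> is the hexagon on 1 to 6 with 0 isolated, \<open>True\<close> the
  spider with centre 0.\<close>

definition leaf :: "bool \<Rightarrow> nat \<Rightarrow> nat \<Rightarrow> bool" where
  "leaf \<tau> a b \<longleftrightarrow>
     (let S = (if \<tau> then {(0, 1), (0, 2), (0, 3), (1, 4), (2, 5), (3, 6)}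
               else {(1, 2), (2, 3), (3, 4), (4, 5), (5, 6), (6, 1)})
      in (a, b) \<in> S \<or> (b, a) \<in> S)"

definition leaf_deg :: "bool \<Rightarrow> nat \<Rightarrow> nat" where
  "leaf_deg \<tau> v = (\<Sum>v'<7. if leaf \<tau> v v' then 1 else 0)"

lemma leaf_sym: "leaf \<tau> a b \<Longrightarrow> leaf \<tau> b a"
  unfolding leaf_def Let_def by (rule disj_commute[THEN iffD1])

lemma leaf_irrefl: "\<not> leaf \<tau> a a"
  by (cases "a = 0") (simp_all add: leaf_def)

lemma less_7_cases: "(v::nat) < 7 \<longleftrightarrow> v = 0 \<or> v = 1 \<or> v = 2 \<or> v = 3 \<or> v = 4 \<or> v = 5 \<or> v = 6"
  by auto

lemma lessThan_7: "{..<7::nat} = {0, 1, 2, 3, 4, 5, 6}"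
  by auto

lemma leaf_deg_eq:
  assumes "v < 7"
  shows "leaf_deg \<tau> v = (if \<tau> then (if v = 0 then 3 else if v < 4 then 2 else 1)
    else (if v = 0 then 0 else 2))"
  using assms unfolding less_7_cases
  by (elim disjE; cases \<tau>) (simp_all add: leaf_deg_def leaf_def lessThan_7)

text \<open>Checked entry by entry, as in 2 + 2 + 2 = 2 * 3 at the centre of the spider. It keeps
  the span of the all-one vector and the degree vector invariant under both leaf graphs.\<close>

lemma sum_leaf_deg_neighbours:
  assumes "v < 7"
  shows "(\<Sum>v'\<in>{v'. v' < 7 \<and> leaf \<tau> v v'}. leaf_deg \<tau> v') = 2 * leaf_deg \<tau> v"
proof -
  have "(\<Sum>v'\<in>{v'. v' < 7 \<and> leaf \<tau> v v'}. leaf_deg \<tau> v') =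
      (\<Sum>v'<7. if leaf \<tau> v v' then leaf_deg \<tau> v' else 0)"
    by (simp add: sum.inter_filter[symmetric])
  also have "\<dots> = 2 * leaf_deg \<tau> v"
    using assms unfolding less_7_cases
    by (elim disjE; cases \<tau>) (simp_all add: leaf_deg_eq leaf_def lessThan_7)
  finally show ?thesis .
qed

lemma card_leaf_neighbours: "card {v'. v' < 7 \<and> leaf \<tau> v v'} = leaf_deg \<tau> v"
  unfolding leaf_deg_def by (simp add: sum.inter_filter[symmetric])

lemma sum_leaf_deg: "(\<Sum>v<7. leaf_deg \<tau> v) = 12"
  by (cases \<tau>) (simp_all add: leaf_deg_eq lessThan_7)


section \<open>A numerical invariant of color refinement\<close>

fun parent :: "color \<Rightarrow> color" where
  "parent CInit = CInit"
| "parent (CRefine c M) = c"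

text \<open>Multiplying by the value of the round before makes totals quadratic, so that joins of
  equal and of different types can be told apart. \<open>potential d k\<close> is meant for colors
  of round \<open>Suc k\<close>, where the recursion never meets \<open>CInit\<close>.\<close>

fun potential :: "nat \<Rightarrow> nat \<Rightarrow> color \<Rightarrow> nat" where
  "potential d 0 (CRefine c M) = (if size M = d then 1 else 0)"
| "potential d (Suc k) (CRefine c M) = potential d k c * (\<Sum>c'\<in>#M. potential d k c')"
| "potential d _ CInit = 0"

text \<open>Every refined color contains its predecessor, so equality after \<open>N\<close> rounds
  descends through \<open>parent\<close> to earlier rounds.\<close>

lemma WL1_eq_imp_cr_eq:
  assumes "WL1 N E1 = WL1 N E2" and "j \<le> N"
  shows "image_mset (cr N E1 j) (mset_set {1..N}) = image_mset (cr N E2 j) (mset_set {1..N})"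
  using assms(2)
proof (induction rule: inc_induct)
  case base
  then show ?case using assms(1) by (simp add: WL1_def)
next
  case (step j)
  from arg_cong[OF step.IH, of "image_mset parent"] show ?case
    by (simp add: multiset.map_comp comp_def)
qed


section \<open>The graphs\<close>

type_synonym vertex = "word \<times> nat"

definition vertices :: "nat \<Rightarrow> vertex set" where
  "vertices m = words m \<times> {..<7}"

text \<open>Only the types of the leaf blocks depend on \<open>s\<close>; edges between different
  blocks are the same in both graphs.\<close>

definition edge :: "bool \<Rightarrow> vertex \<Rightarrow> vertex \<Rightarrow> bool" where
  "edge s a b \<longleftrightarrow>
     (if fst a = fst b then leaf (select s (fst a)) (snd a) (snd b) else odd (sep (fst a) (fst b)))"

lemma finite_vertices [simp]: "finite (vertices m)"
  by (simp add: vertices_def)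

lemma card_vertices: "card (vertices m) = 7 * 4 ^ m"
  by (simp add: vertices_def card_cartesian_product card_words)

lemma sum_vertices:
  fixes f :: "vertex \<Rightarrow> 'a::comm_monoid_add"
  shows "(\<Sum>a\<in>vertices m. f a) = (\<Sum>u\<in>words m. \<Sum>v<7. f (u, v))"
  by (simp add: vertices_def sum.cartesian_product)

lemma edge_sym:
  "a \<in> vertices m \<Longrightarrow> b \<in> vertices m \<Longrightarrow> edge s a b \<Longrightarrow> edge s b a"
  by (auto simp: edge_def vertices_def words_def leaf_sym sep_commute split: if_splits)

lemma edge_irrefl: "\<not> edge s a a"
  by (simp add: edge_def leaf_irrefl)

lemma sum_edge:
  fixes f :: "vertex \<Rightarrow> nat"
  assumes "length u = m"
  shows "(\<Sum>c\<in>{c \<in> vertices m. edge s (u, v) c}. f c) =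
    (\<Sum>v'\<in>{v'. v' < 7 \<and> leaf (select s u) v v'}. f (u, v')) +
    (\<Sum>w\<in>{w \<in> words m. odd (sep u w)}. \<Sum>v'<7. f (w, v'))"
proof -
  have "{c \<in> vertices m. edge s (u, v) c} =
      Pair u ` {v'. v' < 7 \<and> leaf (select s u) v v'} \<union> {w \<in> words m. odd (sep u w)} \<times> {..<7}"
  proof (intro set_eqI)
    fix c :: vertex
    show "c \<in> {c \<in> vertices m. edge s (u, v) c} \<longleftrightarrow>
        c \<in> Pair u ` {v'. v' < 7 \<and> leaf (select s u) v v'} \<union> {w \<in> words m. odd (sep u w)} \<times> {..<7}"
      using assms by (cases c; cases "fst c = u") (simp_all add: vertices_def edge_def words_def image_iff conj_ac)
  qed
  moreover have "Pair u ` {v'. v' < 7 \<and> leaf (select s u) v v'} \<inter>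
      {w \<in> words m. odd (sep u w)} \<times> {..<7} = {}"
    by auto
  ultimately show ?thesis
    by (simp add: sum.union_disjoint sum.reindex inj_on_def sum.cartesian_product)
qed

section \<open>Transport to the vertex set \<open>{1..N}\<close>\<close>

locale encoding =
  fixes m :: nat and enc :: "vertex \<Rightarrow> nat" and N :: nat
  assumes bij: "bij_betw enc (vertices m) {1..N}"
begin

definition E :: "bool \<Rightarrow> nat \<Rightarrow> nat \<Rightarrow> bool" where
  "E s x y \<longleftrightarrow> (\<exists>a\<in>vertices m. \<exists>b\<in>vertices m. x = enc a \<and> y = enc b \<and> edge s a b)"

lemma enc_inj: "inj_on enc (vertices m)"
  and enc_image: "enc ` vertices m = {1..N}"
  using bij by (auto simp: bij_betw_def)

lemma enc_mem: "a \<in> vertices m \<Longrightarrow> enc a \<in> {1..N}"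
  using enc_image by blast

lemma enc_eq_iff: "a \<in> vertices m \<Longrightarrow> b \<in> vertices m \<Longrightarrow> enc a = enc b \<longleftrightarrow> a = b"
  using enc_inj by (auto simp: inj_on_def)

lemma is_graph_E: "is_graph N (E s)"
  unfolding is_graph_def
proof (intro allI impI)
  fix x y
  assume "E s x y"
  then obtain a b where ab: "a \<in> vertices m" "b \<in> vertices m" "x = enc a" "y = enc b" "edge s a b"
    unfolding E_def by blast
  then have "edge s b a" and "a \<noteq> b"
    using edge_sym edge_irrefl by blast+
  with ab show "x \<in> {1..N} \<and> y \<in> {1..N} \<and> x \<noteq> y \<and> E s y x"
    using enc_mem unfolding E_def by (auto simp: enc_eq_iff)
qed

lemma neighbours_enc:
  assumes "a \<in> vertices m"
  shows "{z \<in> {1..N}. E s (enc a) z} = enc ` {c \<in> vertices m. edge s a c}"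
  using assms enc_mem by (auto simp: E_def enc_eq_iff)

lemma inj_on_neighbours: "inj_on enc {c \<in> vertices m. edge s a c}"
  using enc_inj by (auto simp: inj_on_def)

lemma sum_neighbours:
  assumes "a \<in> vertices m"
  shows "(\<Sum>z\<in>{z \<in> {1..N}. E s (enc a) z}. f z) = (\<Sum>c\<in>{c \<in> vertices m. edge s a c}. f (enc c))"
  unfolding neighbours_enc[OF assms] by (simp add: sum.reindex inj_on_neighbours)

lemma image_mset_enc:
  "image_mset f (mset_set {1..N}) = image_mset (\<lambda>a. f (enc a)) (mset_set (vertices m))"
  unfolding enc_image[symmetric] image_mset_mset_set[OF enc_inj, symmetric]
  by (simp add: multiset.map_comp comp_def)


section \<open>Walk counts\<close>

text \<open>The coefficients are shared by both values of \<open>s\<close> and by all targets in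
  blocks of type \<open>\<tau>\<close>, which makes counts comparable across the two graphs.\<close>

definition walk_shape ::
  "nat \<Rightarrow> bool \<Rightarrow> nat \<Rightarrow> (nat \<Rightarrow> nat) \<Rightarrow> (nat \<Rightarrow> nat) \<Rightarrow> (nat \<Rightarrow> nat) \<Rightarrow> bool" where
  "walk_shape k \<tau> v' D \<alpha> \<beta> \<longleftrightarrow> (\<forall>s u w v.
     length u = m \<longrightarrow> select s u = \<tau> \<longrightarrow> length w = m \<longrightarrow> v < 7 \<longrightarrow>
     walks N (E s) k (enc (w, v)) (enc (u, v')) =
       (if w = u then D v else \<alpha> (sep w u) + \<beta> (sep w u) * leaf_deg (select s w) v))"

text \<open>Restricted to a leaf graph that does not contain the target, the number of walks to the target
  stays in the span of the all-one vector and the degree vector; as both leaf graphs act on this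
  span in the same way, the coefficients do not depend on which of them is used where.\<close>

lemma ex_walk_shape:
  assumes "v' < 7"
  shows "\<exists>D \<alpha> \<beta>. walk_shape k \<tau> v' D \<alpha> \<beta>"
proof (induction k)
  case 0
  have "walk_shape 0 \<tau> v' (\<lambda>v. if v = v' then 1 else 0) (\<lambda>_. 0) (\<lambda>_. 0)"
    unfolding walk_shape_def using assms by (auto simp: enc_eq_iff vertices_def words_def)
  then show ?case by (intro exI)
next
  case (Suc k)
  then obtain D \<alpha> \<beta> where "walk_shape k \<tau> v' D \<alpha> \<beta>"
    by (elim exE)
  note IH = this[unfolded walk_shape_def, rule_format]
  \<comment> \<open>Walk total of a block at separation \<open>i\<close>: 7 vertices and degree sum
    12, or the target block itself at \<open>i = 0\<close>.\<close>
  define t where "t i = (if i = 0 then (\<Sum>v<7. D v) else 7 * \<alpha> i + 12 * \<beta> i)" for i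
  show ?case
  proof (rule sum_odd_sep[of m t])
    fix H :: "nat \<Rightarrow> nat"
    assume H: "\<And>z u. length z = m \<Longrightarrow> length u = m \<Longrightarrow>
      (\<Sum>w\<in>{w \<in> words m. odd (sep z w)}. t (sep w u)) = H (sep z u)"
    \<comment> \<open>Leaf edges send the all-one vector to the degree vector and double the latter,
      whence \<open>?\<beta>\<close>; edges between blocks add the constant
      \<open>H i\<close>.\<close>
    let ?D = "\<lambda>v. (\<Sum>v2\<in>{v2. v2 < 7 \<and> leaf \<tau> v v2}. D v2) + H 0"
    let ?\<alpha> = "\<lambda>i. H i"
    let ?\<beta> = "\<lambda>i. \<alpha> i + 2 * \<beta> i"
    have "walks N (E s) (Suc k) (enc (w, v)) (enc (u, v')) =
        (if w = u then ?D v else ?\<alpha> (sep w u) + ?\<beta> (sep w u) * leaf_deg (select s w) v)"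
      if u: "length u = m" "select s u = \<tau>" and w: "length w = m" and v: "v < 7" for s u w v
    proof -
      let ?W = "\<lambda>c. walks N (E s) k (enc c) (enc (u, v'))"
      have block: "(\<Sum>v2<7. ?W (z, v2)) = t (sep z u)" if "z \<in> words m" for z
      proof -
        from that have z: "length z = m" by (simp add: words_def)
        show ?thesis
        proof (cases "z = u")
          case True
          then show ?thesis using u by (simp add: IH t_def)
        next
          case False
          then have "(\<Sum>v2<7. ?W (z, v2)) =
              7 * \<alpha> (sep z u) + \<beta> (sep z u) * (\<Sum>v2<7. leaf_deg (select s z) v2)"
            using u z by (simp add: IH sum.distrib sum_distrib_left)
          moreover have "sep z u \<noteq> 0"
            using False z u by (simp add: sep_eq_0_iff)
          ultimately show ?thesis by (simp add: sum_leaf_deg t_def)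
        qed
      qed
      have "walks N (E s) (Suc k) (enc (w, v)) (enc (u, v')) =
          (\<Sum>c\<in>{c \<in> vertices m. edge s (w, v) c}. ?W c)"
        using w v by (simp only: walks.simps) (rule sum_neighbours, simp add: vertices_def words_def)
      also have "\<dots> = (\<Sum>v2\<in>{v2. v2 < 7 \<and> leaf (select s w) v v2}. ?W (w, v2)) + H (sep w u)"
        unfolding sum_edge[OF w] using w u by (simp add: block flip: H)
      also have "(\<Sum>v2\<in>{v2. v2 < 7 \<and> leaf (select s w) v v2}. ?W (w, v2)) =
          (if w = u then \<Sum>v2\<in>{v2. v2 < 7 \<and> leaf \<tau> v v2}. D v2
           else ?\<beta> (sep w u) * leaf_deg (select s w) v)"
      proof (cases "w = u")
        case True
        then show ?thesis using u by (simp add: IH)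
      next
        case False
        then have "(\<Sum>v2\<in>{v2. v2 < 7 \<and> leaf (select s w) v v2}. ?W (w, v2)) =
            card {v2. v2 < 7 \<and> leaf (select s w) v v2} * \<alpha> (sep w u) +
            \<beta> (sep w u) * (\<Sum>v2\<in>{v2. v2 < 7 \<and> leaf (select s w) v v2}. leaf_deg (select s w) v2)"
          using u w by (simp add: IH sum.distrib sum_distrib_left)
        with False show ?thesis
          by (simp add: card_leaf_neighbours sum_leaf_deg_neighbours[OF v] algebra_simps)
      qed
      finally show ?thesis by auto
    qed
    then have "walk_shape (Suc k) \<tau> v' ?D ?\<alpha> ?\<beta>"
      unfolding walk_shape_def by (intro allI impI)
    then show ?thesis by (intro exI)
  qed
qed

lemma walks_cong:
  assumes "length u = m" "length u' = m" "length w = m" "length w' = m" "v < 7" "v' < 7"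
    and "select s u = select s' w" "select s u' = select s' w'" "sep u u' = sep w w'"
  shows "walks N (E s) k (enc (u, v)) (enc (u', v')) = walks N (E s') k (enc (w, v)) (enc (w', v'))"
proof -
  obtain D \<alpha> \<beta> where "walk_shape k (select s u') v' D \<alpha> \<beta>"
    using ex_walk_shape[OF assms(6), of k "select s u'"] by (elim exE)
  note form = this[unfolded walk_shape_def, rule_format]
  have "u = u' \<longleftrightarrow> w = w'"
    using assms sep_eq_0_iff[of u u'] sep_eq_0_iff[of w w'] by auto
  then show ?thesis
    using assms by (simp add: form)
qed

lemma walk_vec_cong:
  assumes "length u = m" "length u' = m" "length w = m" "length w' = m" "v < 7" "v' < 7"
    and "select s u = select s' w" "select s u' = select s' w'" "sep u u' = sep w w'"
  shows "walk_vec N (E s) (enc (u, v)) (enc (u', v')) = walk_vec N (E s') (enc (w, v)) (enc (w', v'))"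
  unfolding walk_vec_def using walks_cong[OF assms] by simp


section \<open>The invariant \<open>\<omega>\<close>\<close>

lemma image_mset_vertices_split:
  assumes "m = n + Suc k"
  shows "image_mset f (mset_set {1..N}) =
    image_mset (\<lambda>(h, e, l, v). f (enc (h @ e # l, v)))
      (mset_set (words n \<times> UNIV \<times> words k \<times> {..<7}))"
proof -
  let ?g = "\<lambda>(h :: word, e, l, v). (h @ e # l, v :: nat)"
  let ?A = "words n \<times> UNIV \<times> words k \<times> {..<7 :: nat}"
  have inj: "inj_on ?g ?A"
    by (auto simp: inj_on_def words_def)
  have "\<exists>h e l. h \<in> words n \<and> l \<in> words k \<and> u = h @ e # l" if "u \<in> words m" for u
  proof (intro exI conjI)
    have n: "n < length u" using that assms by (simp add: words_def)
    show "take n u \<in> words n" and "drop (Suc n) u \<in> words k"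
      using that assms by (auto simp: words_def)
    show "u = take n u @ u ! n # drop (Suc n) u"
      using n by (rule id_take_nth_drop)
  qed
  then have "vertices m \<subseteq> ?g ` ?A"
    unfolding vertices_def by (force simp: image_iff)
  moreover have "?g ` ?A \<subseteq> vertices m"
    using assms by (auto simp: vertices_def words_def)
  ultimately have "vertices m = ?g ` ?A" by blast
  then have "mset_set (vertices m) = image_mset ?g (mset_set ?A)"
    by (simp only: image_mset_mset_set[OF inj])
  then show ?thesis
    unfolding image_mset_enc
    by (simp add: multiset.map_comp comp_def case_prod_unfold)
qed

text \<open>The bijection translates \<open>h'\<close> so that \<open>h\<close> goes to \<open>h2\<close>, and exchanges the two bits that
  follow \<open>h'\<close> if the two types disagree there.\<close>

lemma omega_cong:
  assumes "length h + r = m" "length h2 = length h" "length l = r" "v < 7"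
    and "select s h = select s' h2"
  shows "omega N (E s) r (enc (h @ l, v)) = omega N (E s') r (enc (h2 @ l, v))"
  using assms
proof (induction r arbitrary: h h2 l v)
  case 0
  then have "walk_vec N (E s) (enc (h, v)) (enc (h, v)) = walk_vec N (E s') (enc (h2, v)) (enc (h2, v))"
    by (intro walk_vec_cong) simp_all
  with 0 show ?case by simp
next
  case (Suc r)
  from Suc.prems(3) obtain e low where l: "l = e # low" and low: "length low = r"
    by (auto simp: length_Suc_conv)
  define n where "n = length h"
  have m: "m = n + Suc r" using Suc.prems(1) by (simp add: n_def)
  have lens: "length h = n" "length h2 = n" using Suc.prems by (simp_all add: n_def)
  define t where "t = xor_word h h2"
  have t: "length t = n" "xor_word t h = h2"
    using lens xor_word_cancel_right[of h2 h] by (simp_all add: t_def)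
  define A :: "(word \<times> (bool \<times> bool) \<times> word \<times> nat) set"
    where "A = words n \<times> UNIV \<times> words r \<times> {..<7}"
  define B :: "word \<times> (bool \<times> bool) \<times> word \<times> nat \<Rightarrow> word \<times> (bool \<times> bool) \<times> word \<times> nat"
    where "B = (\<lambda>(h', e', l', v'). (xor_word t h',
      if select s h' = select s' (xor_word t h') then e' else prod.swap e', l', v'))"
  have fin: "finite A" by (simp add: A_def)
  have "inj_on B A"
  proof (rule inj_onI)
    fix a b
    assume "a \<in> A" "b \<in> A" and eq: "B a = B b"
    obtain h1 e1 l1 v1 h2 e2 l2 v2 where ab: "a = (h1, e1, l1, v1)" "b = (h2, e2, l2, v2)"
      by (cases a; cases b) auto
    have "length h1 = n" "length h2 = n" "xor_word t h1 = xor_word t h2"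
      using \<open>a \<in> A\<close> \<open>b \<in> A\<close> eq by (auto simp: ab A_def B_def words_def)
    then have "h1 = h2" using t(1) xor_word_cancel by metis
    with eq show "a = b" by (auto simp: ab B_def prod_eq_iff split: if_splits)
  qed
  moreover have "B ` A \<subseteq> A"
    by (auto simp: A_def B_def words_def t(1))
  ultimately have BA: "B ` A = A" and inj: "inj_on B A"
    using endo_inj_surj[OF fin] by auto
  let ?x = "enc (h @ l, v)" and ?x2 = "enc (h2 @ l, v)"
  define F where "F = (\<lambda>(h', e', l', v').
    (walk_vec N (E s) ?x (enc (h' @ e' # l', v')), omega N (E s) r (enc (h' @ e' # l', v'))))"
  define F2 where "F2 = (\<lambda>(h', e', l', v').
    (walk_vec N (E s') ?x2 (enc (h' @ e' # l', v')), omega N (E s') r (enc (h' @ e' # l', v'))))"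
  have FB: "F a = F2 (B a)" if "a \<in> A" for a
  proof -
    obtain h' e' l' v' where a: "a = (h', e', l', v')" by (cases a) auto
    with that have len: "length h' = n" "length l' = r" "v' < 7"
      by (auto simp: A_def words_def)
    define h2' where "h2' = xor_word t h'"
    define e2' where "e2' = (if select s h' = select s' h2' then e' else prod.swap e')"
    have len2: "length h2' = n" by (simp add: h2'_def t len)
    \<comment> \<open>\<open>select\<close> reads the first bit for type \<open>False\<close> and
      the second for \<open>True\<close>, so swapping the bits cancels a disagreement and the types
      agree from here on.\<close>
    have type: "select s (h' @ [e']) = select s' (h2' @ [e2'])"
      by (auto simp: e2'_def)
    then have type': "select s (h' @ e' # l') = select s' (h2' @ e2' # l')"
      by simp
    have sep_h: "sep h2 h2' = sep h h'"
      using sep_xor_word[of t h h'] by (simp add: t h2'_def len lens)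
    \<comment> \<open>If \<open>h' = h\<close>, the types agree by assumption and the letter is not
      swapped; otherwise the prefixes already decide \<open>sep\<close>, and a swap cannot affect
      it.\<close>
    have sep: "sep (h @ l) (h' @ e' # l') = sep (h2 @ l) (h2' @ e2' # l')"
    proof (cases "h' = h")
      case True
      then have "h2' = h2" "e2' = e'"
        using t Suc.prems(5) by (simp_all add: h2'_def e2'_def)
      with True show ?thesis by (simp add: sep_append lens l low len)
    next
      case False
      then have "h2' \<noteq> h2"
        using sep_h lens len len2 sep_eq_0_iff[of h h'] sep_eq_0_iff[of h2 h2'] by auto
      with False show ?thesis
        using sep_h by (simp add: sep_append lens len2 l low len)
    qed
    have "walk_vec N (E s) ?x (enc (h' @ e' # l', v')) =
        walk_vec N (E s') ?x2 (enc (h2' @ e2' # l', v'))"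
      using type' sep Suc.prems len len2 lens m low l
      by (intro walk_vec_cong) simp_all
    \<comment> \<open>The letter moves into the prefix: each round consumes one letter of the
      suffix.\<close>
    moreover have "omega N (E s) r (enc ((h' @ [e']) @ l', v')) =
        omega N (E s') r (enc ((h2' @ [e2']) @ l', v'))"
      using type len len2 m by (intro Suc.IH) simp_all
    ultimately show ?thesis
      by (simp add: F_def F2_def B_def a h2'_def e2'_def)
  qed
  have "image_mset F (mset_set A) = image_mset F2 (image_mset B (mset_set A))"
    unfolding multiset.map_comp comp_def using fin FB by (intro image_mset_cong) simp
  also have "\<dots> = image_mset F2 (mset_set A)"
    by (simp only: image_mset_mset_set[OF inj] BA)
  finally have "image_mset (\<lambda>y. (walk_vec N (E s) ?x y, omega N (E s) r y)) (mset_set {1..N}) =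
      image_mset (\<lambda>y. (walk_vec N (E s') ?x2 y, omega N (E s') r y)) (mset_set {1..N})"
    unfolding image_mset_vertices_split[OF m] F_def F2_def A_def .
  moreover have "omega N (E s) r (enc ((h @ [e]) @ low, v)) =
      omega N (E s') r (enc ((h2 @ [e]) @ low, v))"
    using Suc.prems lens m low by (intro Suc.IH) simp_all
  ultimately show ?case by (simp add: l)
qed

text \<open>Swapping the bits of the first letter reconciles the root types \<open>False\<close> and
  \<open>True\<close>; the other \<open>r\<close> letters pay for the \<open>r\<close>
  rounds.\<close>

lemma omega_inv_eq:
  assumes "m = Suc r"
  shows "omega_inv r N (E False) = omega_inv r N (E True)"
proof -
  define A :: "(word \<times> (bool \<times> bool) \<times> word \<times> nat) set"
    where "A = words 0 \<times> UNIV \<times> words r \<times> {..<7}"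
  define B :: "word \<times> (bool \<times> bool) \<times> word \<times> nat \<Rightarrow> word \<times> (bool \<times> bool) \<times> word \<times> nat"
    where "B = (\<lambda>(h, e, l, v). (h, prod.swap e, l, v))"
  have m: "m = 0 + Suc r" using assms by simp
  have inj: "inj_on B A" by (auto simp: inj_on_def B_def prod_eq_iff)
  have BA: "B ` A = A"
    by (rule endo_inj_surj[OF _ _ inj]) (auto simp: A_def B_def)
  have fin: "finite A" by (simp add: A_def)
  define F where "F s = (\<lambda>(h, e, l, v). omega N (E s) r (enc (h @ e # l, v)))" for s
  have FB: "F False a = F True (B a)" if aA: "a \<in> A" for a
  proof -
    obtain e l v where a: "a = ([], e, l, v)" "length l = r" "v < 7"
      using aA by (cases a) (auto simp: A_def words_def)
    then show ?thesis
      using omega_cong[of "[e]" r "[prod.swap e]" l v False True] assms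
      by (simp add: F_def B_def)
  qed
  have "image_mset (F False) (mset_set A) = image_mset (F True) (image_mset B (mset_set A))"
    unfolding multiset.map_comp comp_def using fin FB by (intro image_mset_cong) simp
  also have "\<dots> = image_mset (F True) (mset_set A)"
    by (simp only: image_mset_mset_set[OF inj] BA)
  finally show ?thesis
    unfolding omega_inv_def image_mset_vertices_split[OF m] F_def A_def .
qed


section \<open>Color refinement separates the graphs\<close>

definition pot :: "nat \<Rightarrow> bool \<Rightarrow> nat \<Rightarrow> vertex \<Rightarrow> nat" where
  "pot d s k a = potential d k (cr N (E s) (Suc k) (enc a))"

lemma pot_0:
  assumes "a \<in> vertices m"
  shows "pot d s 0 a = (if card {c \<in> vertices m. edge s a c} = d then 1 else 0)"
  by (simp only: pot_def cr.simps potential.simps size_image_mset size_mset_set neighbours_enc[OF assms]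
      card_image[OF inj_on_neighbours])

lemma pot_Suc:
  assumes "a \<in> vertices m"
  shows "pot d s (Suc k) a = pot d s k a * (\<Sum>c\<in>{c \<in> vertices m. edge s a c}. pot d s k c)"
proof -
  have "pot d s (Suc k) a =
      pot d s k a * (\<Sum>z\<in>{z \<in> {1..N}. E s (enc a) z}. potential d k (cr N (E s) (Suc k) z))"
    unfolding pot_def cr.simps(2)[of N "E s" "Suc k"] potential.simps
    by (simp only: multiset.map_comp comp_def sum_unfold_sum_mset)
  then show ?thesis
    unfolding sum_neighbours[OF assms] pot_def .
qed

text \<open>With \<open>F \<tau>\<close> the total potential of a block of type \<open>\<tau>\<close>, passing to the next level adds
  \<open>2 * F False ^ 2 + 2 * F True ^ 2\<close> to a common value for one type and
  \<open>4 * F False * F True\<close> for the other.\<close>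

lemma pot_separates:
  assumes K: "\<forall>u. length u = m \<longrightarrow> card {w \<in> words m. odd (sep u w)} = K"
  shows "k \<le> m \<Longrightarrow> \<exists>\<phi>.
    (\<forall>s h l v. length h + k = m \<longrightarrow> length l = k \<longrightarrow> v < 7 \<longrightarrow>
      pot (3 + 7 * K) s k (h @ l, v) = \<phi> (select s h) l v) \<and>
    (\<Sum>l\<in>words k. \<Sum>v<7. \<phi> False l v) \<noteq> (\<Sum>l\<in>words k. \<Sum>v<7. \<phi> True l v)"
proof (induction k)
  case 0
  \<comment> \<open>The degree \<open>3 + 7 * K\<close> is that of a spider centre: 3 inside its
    block, and \<open>K\<close> completely joined blocks of 7 vertices. A hexagon block has no such
    vertex.\<close>
  define \<phi> where "\<phi> \<tau> l v = (if leaf_deg \<tau> v = 3 then 1 else 0 :: nat)" for \<tau> and l :: word and v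
  have "pot (3 + 7 * K) s 0 (h, v) = \<phi> (select s h) [] v" if "length h = m" "v < 7" for s h v
  proof -
    have "card {c \<in> vertices m. edge s (h, v) c} = leaf_deg (select s h) v + 7 * K"
      using sum_edge[OF that(1), of "\<lambda>_. 1" s v] K that(1) by (simp add: card_leaf_neighbours)
    then show ?thesis
      using that by (simp add: pot_0 vertices_def words_def \<phi>_def)
  qed
  moreover have "(\<Sum>v<7. \<phi> False [] v) \<noteq> (\<Sum>v<7. \<phi> True [] v)"
    by (simp add: \<phi>_def leaf_deg_eq lessThan_7)
  ultimately show ?case
    by (intro exI[of _ \<phi>]) simp
next
  case (Suc k)
  define d where "d = 3 + 7 * K"
  define n where "n = m - Suc k"
  have m: "m = n + Suc k" using Suc.prems by (simp add: n_def)
  obtain \<phi> where \<phi>: "\<And>s h l v. length h + k = m \<Longrightarrow> length l = k \<Longrightarrow> v < 7 \<Longrightarrow>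
      pot d s k (h @ l, v) = \<phi> (select s h) l v"
    and neq: "(\<Sum>l\<in>words k. \<Sum>v<7. \<phi> False l v) \<noteq> (\<Sum>l\<in>words k. \<Sum>v<7. \<phi> True l v)"
  proof -
    have "k \<le> m" using Suc.prems by simp
    from Suc.IH[OF this] show thesis
      unfolding d_def[symmetric] by (elim exE conjE) (rule that, simp_all)
  qed
  define F where "F \<tau> = (\<Sum>l\<in>words k. \<Sum>v<7. \<phi> \<tau> l v)" for \<tau>
  define sub where "sub \<tau> e = (if \<tau> then snd e else fst e)" for \<tau> and e :: "bool \<times> bool"
  show ?case
  proof (rule card_odd_sep[of n])
    fix K'
    assume K': "\<And>u. length u = n \<Longrightarrow> card {w \<in> words n. odd (sep u w)} = K'"
    \<comment> \<open>\<open>C\<close> comes from blocks joined further out: each of the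
      \<open>K'\<close> prefixes carries two blocks of each type, whatever its own type is.\<close>
    define C where "C = K' * (2 * F False + 2 * F True)"
    define I where "I \<sigma> l v = (\<Sum>v'\<in>{v'. v' < 7 \<and> leaf (select \<sigma> l) v v'}. \<phi> \<sigma> l v') +
      (\<Sum>l'\<in>{l' \<in> words k. odd (sep l l')}. \<Sum>v'<7. \<phi> \<sigma> l' v') + C" for \<sigma> l v
    define \<psi> where "\<psi> \<tau> l v = (case l of [] \<Rightarrow> 0 | e # l' \<Rightarrow>
      \<phi> (sub \<tau> e) l' v * (I (sub \<tau> e) l' v + F (sub \<tau> (fst e, \<not> snd e))))" for \<tau> l v
    have outer: "(\<Sum>w\<in>{w \<in> words m. odd (sep (h @ e # l) w)}. \<Sum>v<7. pot d s k (w, v)) =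
        (\<Sum>l'\<in>{l' \<in> words k. odd (sep l l')}. \<Sum>v<7. \<phi> (sub (select s h) e) l' v) +
        F (sub (select s h) (fst e, \<not> snd e)) + C"
      if h: "length h = n" and l: "length l = k" for s h e l
    proof -
      let ?\<tau> = "select s h"
      define G where "G h' e' = (\<Sum>l'\<in>words k. if odd (sep (h @ e # l) (h' @ e' # l'))
        then \<Sum>v<7. \<phi> (sub (select s h') e') l' v else 0)" for h' e'
      have "(\<Sum>w\<in>{w \<in> words m. odd (sep (h @ e # l) w)}. \<Sum>v<7. pot d s k (w, v)) =
          (\<Sum>w\<in>words m. if odd (sep (h @ e # l) w) then \<Sum>v<7. pot d s k (w, v) else 0)"
        by (simp add: sum.inter_filter)
      also have "\<dots> = (\<Sum>h'\<in>words n. \<Sum>e'\<in>UNIV. G h' e')"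
        unfolding sum_words_split[OF m] G_def
      proof (intro sum.cong refl if_cong)
        fix h' e' l' v
        assume "h' \<in> words n" "l' \<in> words k" "v \<in> {..<7::nat}"
        then show "pot d s k (h' @ e' # l', v) = \<phi> (sub (select s h') e') l' v"
          using \<phi>[of "h' @ [e']" l' v s] m by (simp add: words_def sub_def)
      qed
      also have "\<dots> = (\<Sum>e'\<in>UNIV. G h e') + (\<Sum>h'\<in>words n - {h}. \<Sum>e'\<in>UNIV. G h' e')"
        using h by (intro sum.remove) (simp_all add: words_iff)
      also have "(\<Sum>e'\<in>UNIV. G h e') =
          (\<Sum>l'\<in>{l' \<in> words k. odd (sep l l')}. \<Sum>v<7. \<phi> (sub ?\<tau> e) l' v) +
          F (sub ?\<tau> (fst e, \<not> snd e))"
      proof -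
        have "G h e' = (if e' = e then
            (\<Sum>l'\<in>{l' \<in> words k. odd (sep l l')}. \<Sum>v<7. \<phi> (sub ?\<tau> e) l' v)
          else if fst e' = fst e then F (sub ?\<tau> e') else 0)" for e'
        proof -
          \<comment> \<open>After the common prefix \<open>h\<close>, odd \<open>sep\<close> means
            either the same block with odd \<open>sep l l'\<close>, or the other factor of the same
            summand.\<close>
          have "G h e' = (\<Sum>l'\<in>words k. if (if e' = e then odd (sep l l') else fst e' = fst e)
              then \<Sum>v<7. \<phi> (sub ?\<tau> e') l' v else 0)"
            unfolding G_def by (rule sum.cong) (auto simp: sep_append words_iff l)
          then show ?thesis
            by (cases "e' = e") (auto simp: F_def sum.inter_filter)
        qed
        then show ?thesis
          by (cases e; cases "fst e"; cases "snd e") (simp_all add: sum_bool_pair)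
      qed
      also have "(\<Sum>h'\<in>words n - {h}. \<Sum>e'\<in>UNIV. G h' e') = C"
      proof -
        have "(\<Sum>e'\<in>UNIV. G h' e') = (if odd (sep h h') then 2 * F False + 2 * F True else 0)"
          if "h' \<in> words n - {h}" for h'
        proof -
          have "G h' e' = (if odd (sep h h') then F (sub (select s h') e') else 0)" for e'
          proof -
            have "G h' e' = (\<Sum>l'\<in>words k. if odd (sep h h')
                then \<Sum>v<7. \<phi> (sub (select s h') e') l' v else 0)"
              unfolding G_def using h that by (intro sum.cong) (auto simp: sep_append words_iff l)
            then show ?thesis by (simp add: F_def)
          qed
          then show ?thesis by (simp add: sum_bool_pair sub_def)
        qed
        then have "(\<Sum>h'\<in>words n - {h}. \<Sum>e'\<in>UNIV. G h' e') =
            (\<Sum>h'\<in>words n - {h}. if odd (sep h h') then 2 * F False + 2 * F True else 0)"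
          by (intro sum.cong) simp_all
        also have "\<dots> = (\<Sum>h'\<in>words n. if odd (sep h h') then 2 * F False + 2 * F True else 0)"
          by (rule sum.mono_neutral_left) auto
        also have "\<dots> = C"
          using K'[OF h] by (simp add: sum.inter_filter[symmetric] C_def)
        finally show ?thesis .
      qed
      finally show ?thesis by simp
    qed
    have "pot d s (Suc k) (h @ l, v) = \<psi> (select s h) l v"
      if h: "length h + Suc k = m" and l: "length l = Suc k" and v: "v < 7" for s h l v
    proof -
      from l obtain e low where low: "l = e # low" "length low = k"
        by (auto simp: length_Suc_conv)
      have hn: "length h = n" using h m by simp
      let ?\<sigma> = "sub (select s h) e"
      have type: "select s (h @ l) = select ?\<sigma> low"
        by (simp add: low sub_def)
      have pot_k: "pot d s k (h @ l, v') = \<phi> ?\<sigma> low v'" if "v' < 7" for v'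
        using \<phi>[of "h @ [e]" low v' s] that h low by (simp add: sub_def)
      have "pot d s (Suc k) (h @ l, v) =
          pot d s k (h @ l, v) * (\<Sum>c\<in>{c \<in> vertices m. edge s (h @ l, v) c}. pot d s k c)"
        using h l v by (intro pot_Suc) (simp add: vertices_def words_def)
      also have "(\<Sum>c\<in>{c \<in> vertices m. edge s (h @ l, v) c}. pot d s k c) =
          (\<Sum>v'\<in>{v'. v' < 7 \<and> leaf (select s (h @ l)) v v'}. pot d s k (h @ l, v')) +
          (\<Sum>w\<in>{w \<in> words m. odd (sep (h @ l) w)}. \<Sum>v'<7. pot d s k (w, v'))"
        using h l by (intro sum_edge) simp
      also have "(\<Sum>v'\<in>{v'. v' < 7 \<and> leaf (select s (h @ l)) v v'}. pot d s k (h @ l, v')) =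
          (\<Sum>v'\<in>{v'. v' < 7 \<and> leaf (select ?\<sigma> low) v v'}. \<phi> ?\<sigma> low v')"
        unfolding type by (intro sum.cong refl) (simp add: pot_k)
      also have "(\<Sum>w\<in>{w \<in> words m. odd (sep (h @ l) w)}. \<Sum>v'<7. pot d s k (w, v')) =
          (\<Sum>l'\<in>{l' \<in> words k. odd (sep low l')}. \<Sum>v<7. \<phi> ?\<sigma> l' v) +
          F (sub (select s h) (fst e, \<not> snd e)) + C"
        unfolding low(1) by (rule outer[OF hn low(2)])
      finally show ?thesis
        unfolding pot_k[OF v] by (simp add: \<psi>_def I_def low(1))
    qed
    moreover have "(\<Sum>l\<in>words (Suc k). \<Sum>v<7. \<psi> False l v) \<noteq>
        (\<Sum>l\<in>words (Suc k). \<Sum>v<7. \<psi> True l v)"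
    proof -
      \<comment> \<open>Each \<open>J \<sigma>\<close> occurs twice in both totals, so only the
        products of joined pairs can differ.\<close>
      define J where "J \<sigma> = (\<Sum>l\<in>words k. \<Sum>v<7. \<phi> \<sigma> l v * I \<sigma> l v)" for \<sigma>
      have total: "(\<Sum>l\<in>words (Suc k). \<Sum>v<7. \<psi> \<tau> l v) =
          (\<Sum>e\<in>UNIV. J (sub \<tau> e) + F (sub \<tau> e) * F (sub \<tau> (fst e, \<not> snd e)))" for \<tau>
        unfolding sum_words_Suc \<psi>_def J_def F_def
        by (simp add: distrib_left sum.distrib sum_distrib_right)
      have "F False \<noteq> F True" using neq by (simp add: F_def)
      \<comment> \<open>The two totals differ by twice this square; passing to integers avoids
        truncated subtraction.\<close>
      then have "(int (F False) - int (F True)) ^ 2 \<noteq> 0" by simp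
      then have "int (F False * F False + F True * F True) \<noteq> int (2 * (F False * F True))"
        by (simp add: power2_eq_square algebra_simps)
      then have "F False * F False + F True * F True \<noteq> 2 * (F False * F True)"
        by (simp only: of_nat_eq_iff) simp
      then show ?thesis
        unfolding total sum_bool_pair sub_def by (simp add: mult.commute[of "F True" "F False"])
    qed
    ultimately show ?thesis
      unfolding d_def by (intro exI[of _ \<psi>]) blast
  qed
qed

lemma WL1_neq: "WL1 N (E False) \<noteq> WL1 N (E True)"
proof (rule card_odd_sep[of m])
  fix K
  assume "\<And>u. length u = m \<Longrightarrow> card {w \<in> words m. odd (sep u w)} = K"
  then have K: "\<forall>u. length u = m \<longrightarrow> card {w \<in> words m. odd (sep u w)} = K"
    by blast
  obtain \<phi> where \<phi>: "\<And>s h l v. length h + m = m \<Longrightarrow> length l = m \<Longrightarrow> v < 7 \<Longrightarrow>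
      pot (3 + 7 * K) s m (h @ l, v) = \<phi> (select s h) l v"
    and neq: "(\<Sum>l\<in>words m. \<Sum>v<7. \<phi> False l v) \<noteq> (\<Sum>l\<in>words m. \<Sum>v<7. \<phi> True l v)"
    using pot_separates[OF K order_refl] by (elim exE conjE) (rule that, simp_all)
  have N: "N = 7 * 4 ^ m"
    using bij_betw_same_card[OF bij] by (simp add: card_vertices)
  \<comment> \<open>The invariant lives in round \<open>Suc m\<close>, which must be among the
    \<open>N\<close> rounds behind \<open>WL1\<close>.\<close>
  have "m < 4 ^ m" by (rule power_gt_expt) simp
  then have "Suc m \<le> N" by (simp add: N)
  have total: "(\<Sum>c\<in>#image_mset (cr N (E s) (Suc m)) (mset_set {1..N}). potential (3 + 7 * K) m c) =
      (\<Sum>l\<in>words m. \<Sum>v<7. \<phi> s l v)" for s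
  proof -
    have "(\<Sum>c\<in>#image_mset (cr N (E s) (Suc m)) (mset_set {1..N}). potential (3 + 7 * K) m c) =
        (\<Sum>a\<in>vertices m. pot (3 + 7 * K) s m a)"
      unfolding image_mset_enc pot_def
      by (simp only: multiset.map_comp comp_def sum_unfold_sum_mset)
    also have "\<dots> = (\<Sum>l\<in>words m. \<Sum>v<7. \<phi> s l v)"
      unfolding sum_vertices
    proof (intro sum.cong refl)
      fix l v
      assume "l \<in> words m" "v \<in> {..<7::nat}"
      then show "pot (3 + 7 * K) s m (l, v) = \<phi> s l v"
        using \<phi>[of "[]" l v s] by (simp add: words_def)
    qed
    finally show ?thesis .
  qed
  show ?thesis
  proof
    assume "WL1 N (E False) = WL1 N (E True)"
    from WL1_eq_imp_cr_eq[OF this \<open>Suc m \<le> N\<close>] total[of False] total[of True] neq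
    show False by metis
  qed
qed

end

text \<open>Words of length \<open>Suc r\<close> suffice: one letter for the swap at the root and
  one for each round.\<close>

theorem omega_not_refine_WL1:
  "\<exists>N E1 E2. is_graph N E1 \<and> is_graph N E2 \<and>
    omega_inv r N E1 = omega_inv r N E2 \<and> WL1 N E1 \<noteq> WL1 N E2"
proof -
  obtain g where "bij_betw g (vertices (Suc r)) {1..card (vertices (Suc r))}"
    using ex_bij_betw_nat_finite_1[OF finite_vertices] bij_betw_inv by blast
  then interpret encoding "Suc r" g "card (vertices (Suc r))"
    by unfold_locales
  show ?thesis
    using is_graph_E omega_inv_eq WL1_neq by blast
qed

theorem theorem6p7:
  shows "\<exists>N1 E1 N2 E2. is_graph N1 E1 \<and> is_graph N2 E2 \<and>
           omega_inv 3 N1 E1 = omega_inv 3 N2 E2 \<and> WL1 N1 E1 \<noteq> WL1 N2 E2"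
  using omega_not_refine_WL1[of 3] by blast

end
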